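(* Let $G$ be a finite group and let $F$ be a nondecreasing real-valued function defined on the natural numbers. Suppose that every homomorphic image of $G$ is good for $F$. Let $A$, $B$ and $D$ be conjugacy classes of $G$ with $D\subseteq AB$. Then ${\bf C}_G(D)/({\bf C}_G(A)\cap{\bf C}_G(B))$ is solvable with derived length at most $1+F(\eta(AB))$.
   Context: For subsets $A,B$ of a group $G$, $AB=\{xy\mid x\in A,\ y\in B\}$, and $A^{-1}=\{x^{-1}\mid x\in A\}$. If $A$ and $B$ are conjugacy classes of a finite group $G$, then $AB$ is a union of conjugacy classes of $G$; $\eta(AB)$ denotes the number of distinct conjugacy classes of $G$ whose union is $AB$. For a subset $X$ of $G$, ${\bf C}_G(X)=\{g\in G\mid g^{-1}xg=x\text{ for all }x\in X\}$ is the centralizer of $X$ in $G$. Since $D$ is a conjugacy class contained in $AB$, the normal subgroup ${\bf C}_G(A)\cap{\bf C}_G(B)$ is contained in ${\bf C}_G(D)$. Definition of "good": for a nondecreasing function $F$ defined on the natural numbers, a finite group $H$ is good for $F$ if for every conjugacy class $A$ of $H$, the group $H/{\bf C}_H(A)$ is solvable with derived length at most $F(\eta(AA^{-1}))$, where $\eta(AA^{-1})$ is the number of distinct conjugacy classes of $H$ whose union is $AA^{-1}$. *)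

theory Defs
  imports "HOL-Algebra.Algebra"
begin

text \<open>Conjugacy classes are the orbits of the library's conjugation action
  (see the library theorem \<open>action_by_conjugation\<close>).\<close>

definition conjugacy_classes :: "('a, 'b) monoid_scheme \<Rightarrow> 'a set set" where
  "conjugacy_classes G =
     orbits G (carrier G) (\<lambda>g. \<lambda>x\<in>carrier G. g \<otimes>\<^bsub>G\<^esub> x \<otimes>\<^bsub>G\<^esub> inv\<^bsub>G\<^esub> g)"

definition centralizer :: "('a, 'b) monoid_scheme \<Rightarrow> 'a set \<Rightarrow> 'a set" where
  "centralizer G S = {g \<in> carrier G. \<forall>x\<in>S. inv\<^bsub>G\<^esub> g \<otimes>\<^bsub>G\<^esub> x \<otimes>\<^bsub>G\<^esub> g = x}"

text \<open>Meaningful only when \<open>S\<close> is a union of conjugacy classes; the family of classes with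
  union \<open>S\<close> is then unique (lemma \<open>eta_Union\<close> below).\<close>

definition eta :: "('a, 'b) monoid_scheme \<Rightarrow> 'a set \<Rightarrow> nat" where
  "eta G S = card (THE K. K \<subseteq> conjugacy_classes G \<and> \<Union>K = S)"

text \<open>Meaningful only for solvable \<open>G\<close>; always used together with \<open>solvable G\<close>.\<close>

definition derived_length :: "('a, 'b) monoid_scheme \<Rightarrow> nat" where
  "derived_length G = (LEAST n. (derived G ^^ n) (carrier G) = {\<one>\<^bsub>G\<^esub>})"

definition good_for :: "(nat \<Rightarrow> real) \<Rightarrow> ('a, 'b) monoid_scheme \<Rightarrow> bool" where
  "good_for F H \<longleftrightarrow> (\<forall>A \<in> conjugacy_classes H.
     solvable (H Mod centralizer H A) \<and>
     real (derived_length (H Mod centralizer H A)) \<le> F (eta H (A <#>\<^bsub>H\<^esub> set_inv\<^bsub>H\<^esub> A)))"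

lemma (in group) eta_Union:
  assumes "K \<subseteq> conjugacy_classes G"
  shows "eta G (\<Union>K) = card K"
proof -
  let ?c = "\<lambda>g. \<lambda>x\<in>carrier G. g \<otimes> x \<otimes> inv g"
  interpret act: group_action G "carrier G" ?c
    by (rule action_by_conjugation)
  have disj: "C \<inter> C' = {}"
    if "C \<in> conjugacy_classes G" "C' \<in> conjugacy_classes G" "C \<noteq> C'" for C C'
    using act.disjoint_union that unfolding conjugacy_classes_def by blast
  have ne: "C \<noteq> {}" if C: "C \<in> conjugacy_classes G" for C
  proof -
    obtain x where "C = orbit G ?c x"
      using C unfolding conjugacy_classes_def orbits_def by blast
    then have "?c \<one> x \<in> C"
      unfolding orbit_def using one_closed by blast
    then show ?thesis by blast
  qed
  have sub: "L \<subseteq> M" if L: "L \<subseteq> conjugacy_classes G" and M: "M \<subseteq> conjugacy_classes G"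
    and LM: "\<Union>L = \<Union>M" for L M
  proof
    fix C assume C: "C \<in> L"
    obtain x where x: "x \<in> C" using ne C L by blast
    then obtain C' where C': "C' \<in> M" "x \<in> C'" using C LM by blast
    then have "C = C'" using disj[of C C'] x C L M by blast
    then show "C \<in> M" using C' by simp
  qed
  have "(THE L. L \<subseteq> conjugacy_classes G \<and> \<Union>L = \<Union>K) = K"
  proof (rule the_equality)
    fix L assume "L \<subseteq> conjugacy_classes G \<and> \<Union>L = \<Union>K"
    then show "L = K"
      using assms sub[of L K] sub[of K L] by (intro subset_antisym) simp_all
  qed (use assms in simp)
  then show ?thesis unfolding eta_def by simp
qed

end

theory Submission
  imports Defs
begin

text \<open>
  Let \<open>M\<close> be the subgroup generated by \<open>D\<close>. It is normal, and it is centralized by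
  \<open>C = C\<^sub>G(D)\<close>. Modulo \<open>M\<close> the class \<open>D\<close> becomes trivial, so \<open>B\<close> becomes \<open>A\<^sup>-\<^sup>1\<close> and \<open>AB\<close> maps
  onto \<open>AA\<^sup>-\<^sup>1\<close>; hence \<open>\<eta>(AA\<^sup>-\<^sup>1)\<close>, computed in \<open>G/M\<close>, is at most \<open>\<eta>(AB)\<close>. As \<open>G/M\<close> is good,
  the \<open>l\<close>-th derived subgroup of \<open>G\<close> commutes with \<open>A\<close> modulo \<open>M\<close> for some \<open>l \<le> F(\<eta>(AB))\<close>.
  For \<open>a \<in> A\<close> and \<open>x\<close> in the \<open>l\<close>-th derived subgroup of \<open>C\<close>, the commutator \<open>a\<^sup>-\<^sup>1 x a x\<^sup>-\<^sup>1\<close> then lies in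
  the abelian group \<open>M \<inter> C\<close>, which is central in \<open>C\<close>, and depends multiplicatively on \<open>x\<close>. So one
  further commutator subgroup centralizes \<open>a\<close>, and being inside \<open>C\<close> also the matching \<open>b \<in> B\<close>
  with \<open>ab \<in> D\<close>.
\<close>

section \<open>Conjugacy classes and centralizers\<close>

lemma (in group) inv_mult_cancel:
  assumes "x \<in> carrier G" and "y \<in> carrier G"
  shows "inv x \<otimes> (x \<otimes> y) = y" and "x \<otimes> (inv x \<otimes> y) = y"
  using assms by (simp_all flip: m_assoc)

lemma (in group) conjugacy_classes_eq:
  "conjugacy_classes G = (\<lambda>x. (\<lambda>g. g \<otimes> x \<otimes> inv g) ` carrier G) ` carrier G"
  unfolding conjugacy_classes_def orbits_def orbit_def by (auto simp: image_def)

lemma (in group) conjugacy_class_subset: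
  assumes "A \<in> conjugacy_classes G"
  shows "A \<subseteq> carrier G"
  using assms unfolding conjugacy_classes_eq by auto

lemma (in group) conjugacy_class_conj_closed:
  assumes "A \<in> conjugacy_classes G" and "x \<in> A" and "g \<in> carrier G"
  shows "g \<otimes> x \<otimes> inv g \<in> A"
proof -
  obtain y k where y: "y \<in> carrier G" "A = (\<lambda>g. g \<otimes> y \<otimes> inv g) ` carrier G"
    and k: "k \<in> carrier G" "x = k \<otimes> y \<otimes> inv k"
    using assms unfolding conjugacy_classes_eq by auto
  have "g \<otimes> x \<otimes> inv g = (g \<otimes> k) \<otimes> y \<otimes> inv (g \<otimes> k)"
    using y k assms(3) by (simp add: m_assoc inv_mult_group)
  then show ?thesis using y k assms(3) by blast
qed

text \<open>Right translation by the inverse of the conjugating element reparametrises the orbit, so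
  every member serves as base point.\<close>

lemma (in group) conjugacy_class_eq_orbit:
  assumes "A \<in> conjugacy_classes G" and "x \<in> A"
  shows "A = (\<lambda>g. g \<otimes> x \<otimes> inv g) ` carrier G"
proof
  show "(\<lambda>g. g \<otimes> x \<otimes> inv g) ` carrier G \<subseteq> A"
    using conjugacy_class_conj_closed[OF assms] by blast
  obtain y k where y: "y \<in> carrier G" "A = (\<lambda>g. g \<otimes> y \<otimes> inv g) ` carrier G"
    and k: "k \<in> carrier G" "x = k \<otimes> y \<otimes> inv k"
    using assms unfolding conjugacy_classes_eq by auto
  have "g \<otimes> y \<otimes> inv g = (g \<otimes> inv k) \<otimes> x \<otimes> inv (g \<otimes> inv k)" if "g \<in> carrier G" for g
    using y(1) k that by (simp add: m_assoc inv_mult_group inv_mult_cancel)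
  then show "A \<subseteq> (\<lambda>g. g \<otimes> x \<otimes> inv g) ` carrier G"
    using k(1) y(2) by blast
qed

text \<open>Provides the family of classes that \<open>eta\<close> counts.\<close>

lemma (in group) Union_of_conjugacy_classes:
  assumes "S \<subseteq> carrier G" and "\<And>x g. x \<in> S \<Longrightarrow> g \<in> carrier G \<Longrightarrow> g \<otimes> x \<otimes> inv g \<in> S"
  obtains K where "K \<subseteq> conjugacy_classes G" and "\<Union>K = S"
proof
  let ?K = "(\<lambda>x. (\<lambda>g. g \<otimes> x \<otimes> inv g) ` carrier G) ` S"
  show "?K \<subseteq> conjugacy_classes G" using assms(1) unfolding conjugacy_classes_eq by auto
  have "x = \<one> \<otimes> x \<otimes> inv \<one>" if "x \<in> S" for x using that assms(1) by auto
  then show "\<Union>?K = S" using assms(2) by blast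
qed

lemma (in group) set_mult_conj_closed:
  assumes "A \<in> conjugacy_classes G" and "B \<in> conjugacy_classes G"
    and "x \<in> A <#> B" and "g \<in> carrier G"
  shows "g \<otimes> x \<otimes> inv g \<in> A <#> B"
proof -
  obtain a b where ab: "a \<in> A" "b \<in> B" "x = a \<otimes> b"
    using assms(3) unfolding set_mult_def by auto
  then have c: "a \<in> carrier G" "b \<in> carrier G" using assms conjugacy_class_subset by auto
  have "g \<otimes> x \<otimes> inv g = (g \<otimes> a \<otimes> inv g) \<otimes> (g \<otimes> b \<otimes> inv g)"
    using ab c assms(4) by (simp add: m_assoc inv_mult_cancel)
  moreover have "g \<otimes> a \<otimes> inv g \<in> A" "g \<otimes> b \<otimes> inv g \<in> B"
    using assms(1,2,4) ab conjugacy_class_conj_closed by auto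
  ultimately show ?thesis unfolding set_mult_def by blast
qed

section \<open>Images of classes under surjective homomorphisms\<close>

lemma (in group_hom) conjugacy_class_img:
  assumes "h ` carrier G = carrier H" and "A \<in> conjugacy_classes G"
  shows "h ` A \<in> conjugacy_classes H"
proof -
  obtain x where x: "x \<in> carrier G" "A = (\<lambda>g. g \<otimes> x \<otimes> inv g) ` carrier G"
    using assms(2) unfolding G.conjugacy_classes_eq by auto
  have "h ` A = (\<lambda>g. h g \<otimes>\<^bsub>H\<^esub> h x \<otimes>\<^bsub>H\<^esub> inv\<^bsub>H\<^esub> h g) ` carrier G"
    unfolding x(2) image_image using x(1) by (intro image_cong) auto
  also have "\<dots> = (\<lambda>g. g \<otimes>\<^bsub>H\<^esub> h x \<otimes>\<^bsub>H\<^esub> inv\<^bsub>H\<^esub> g) ` carrier H"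
    unfolding assms(1)[symmetric] image_image ..
  finally show ?thesis unfolding H.conjugacy_classes_eq using x(1) by auto
qed

lemma (in group_hom) eta_img_le:
  assumes "h ` carrier G = carrier H" and "finite (carrier G)" and "S \<subseteq> carrier G"
    and "\<And>x g. x \<in> S \<Longrightarrow> g \<in> carrier G \<Longrightarrow> g \<otimes> x \<otimes> inv g \<in> S"
  shows "eta H (h ` S) \<le> eta G S"
proof -
  obtain K where K: "K \<subseteq> conjugacy_classes G" "\<Union>K = S"
    using G.Union_of_conjugacy_classes[OF assms(3,4)] .
  \<comment> \<open>An infinite \<open>K\<close> would have \<open>card K = 0\<close>, and the bound
    could fail.\<close>
  have "finite (conjugacy_classes G)"
    unfolding G.conjugacy_classes_eq using assms(2) by simp
  then have fin: "finite K" using K(1) finite_subset by blast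
  have "(`) h ` K \<subseteq> conjugacy_classes H"
    using K(1) conjugacy_class_img[OF assms(1)] by blast
  then have "eta H (\<Union>((`) h ` K)) = card ((`) h ` K)" by (rule H.eta_Union)
  moreover have "h ` S = \<Union>((`) h ` K)" using K(2) by auto
  ultimately show ?thesis
    using card_image_le[OF fin, of "(`) h"] G.eta_Union[OF K(1)] K(2) by simp
qed

section \<open>Centralizers\<close>

lemma (in group) centralizer_iff:
  assumes "S \<subseteq> carrier G"
  shows "g \<in> centralizer G S \<longleftrightarrow> g \<in> carrier G \<and> (\<forall>x\<in>S. x \<otimes> g = g \<otimes> x)"
proof -
  have "inv g \<otimes> x \<otimes> g = x \<longleftrightarrow> x \<otimes> g = g \<otimes> x" if "x \<in> S" "g \<in> carrier G" for x
    using that assms by (metis inv_closed inv_solve_left m_assoc m_closed subsetD)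
  then show ?thesis unfolding centralizer_def by auto
qed

lemma (in group) centralizer_subgroup:
  assumes "S \<subseteq> carrier G"
  shows "subgroup (centralizer G S) G"
proof (rule subgroupI)
  show "centralizer G S \<subseteq> carrier G" unfolding centralizer_def by auto
  have "\<one> \<in> centralizer G S" using assms by (auto simp: centralizer_iff)
  then show "centralizer G S \<noteq> {}" by blast
next
  fix g assume "g \<in> centralizer G S"
  then have g: "g \<in> carrier G" and gx: "\<And>x. x \<in> S \<Longrightarrow> x \<otimes> g = g \<otimes> x"
    using assms by (auto simp: centralizer_iff)
  have "x \<otimes> inv g = inv g \<otimes> x" if x: "x \<in> S" for x
  proof -
    have "x \<in> carrier G" using x assms by blast
    moreover have "inv g \<otimes> (x \<otimes> g) \<otimes> inv g = inv g \<otimes> (g \<otimes> x) \<otimes> inv g" using gx[OF x] by simp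
    ultimately show ?thesis using g by (simp add: m_assoc inv_mult_cancel)
  qed
  then show "inv g \<in> centralizer G S"
    using \<open>g \<in> centralizer G S\<close> assms by (auto simp: centralizer_iff)
next
  fix g k assume "g \<in> centralizer G S" "k \<in> centralizer G S"
  then have c: "g \<in> carrier G" "k \<in> carrier G"
    and gx: "\<And>x. x \<in> S \<Longrightarrow> x \<otimes> g = g \<otimes> x" and kx: "\<And>x. x \<in> S \<Longrightarrow> x \<otimes> k = k \<otimes> x"
    using assms by (auto simp: centralizer_iff)
  have "x \<otimes> (g \<otimes> k) = g \<otimes> k \<otimes> x" if x: "x \<in> S" for x
    using c gx[OF x] kx[OF x] x assms by (metis m_assoc subsetD)
  then show "g \<otimes> k \<in> centralizer G S" using c assms by (auto simp: centralizer_iff)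
qed

lemma (in group) centralizer_normal:
  assumes "S \<subseteq> carrier G" and "\<And>x g. x \<in> S \<Longrightarrow> g \<in> carrier G \<Longrightarrow> g \<otimes> x \<otimes> inv g \<in> S"
  shows "centralizer G S \<lhd> G"
proof (rule normal_invI[OF centralizer_subgroup[OF assms(1)]])
  fix g c assume g: "g \<in> carrier G" and "c \<in> centralizer G S"
  then have c: "c \<in> carrier G" and cx: "\<And>x. x \<in> S \<Longrightarrow> x \<otimes> c = c \<otimes> x"
    using assms by (auto simp: centralizer_iff)
  have "x \<otimes> (g \<otimes> c \<otimes> inv g) = g \<otimes> c \<otimes> inv g \<otimes> x" if x: "x \<in> S" for x
  proof -
    \<comment> \<open>Invariance keeps \<open>?y\<close> in \<open>S\<close>, so \<open>c\<close>
      commutes with it; conjugating that relation by \<open>g\<close> turns \<open>?y\<close> back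
      into \<open>x\<close>.\<close>
    let ?y = "inv g \<otimes> x \<otimes> g"
    have xc: "x \<in> carrier G" using x assms(1) by blast
    have "?y \<in> S" using assms(2)[OF x, of "inv g"] g by simp
    then have "g \<otimes> (?y \<otimes> c) \<otimes> inv g = g \<otimes> (c \<otimes> ?y) \<otimes> inv g" using cx by simp
    then show ?thesis using g c xc by (simp add: m_assoc inv_mult_cancel)
  qed
  then show "g \<otimes> c \<otimes> inv g \<in> centralizer G S" using assms(1) c g by (auto simp: centralizer_iff)
qed

lemma (in group) centralizer_conjugacy_class_normal:
  assumes "A \<in> conjugacy_classes G"
  shows "centralizer G A \<lhd> G"
  using assms conjugacy_class_subset conjugacy_class_conj_closed by (intro centralizer_normal) auto

lemma (in group) subset_centralizer_commute:
  assumes "S \<subseteq> carrier G" and "T \<subseteq> carrier G"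
  shows "S \<subseteq> centralizer G T \<longleftrightarrow> T \<subseteq> centralizer G S"
  using assms by (auto simp: centralizer_iff subset_iff)

text \<open>The double centralizer of \<open>S\<close> is a subgroup containing \<open>S\<close>,
  hence contains what \<open>S\<close> generates.\<close>

lemma (in group) centralizer_generate:
  assumes "S \<subseteq> carrier G"
  shows "centralizer G (generate G S) = centralizer G S"
proof
  show "centralizer G (generate G S) \<subseteq> centralizer G S"
    using generate.incl[of _ S G] unfolding centralizer_def by auto
  have sub: "centralizer G S \<subseteq> carrier G" unfolding centralizer_def by auto
  then have "generate G S \<subseteq> centralizer G (centralizer G S)"
    using subset_centralizer_commute[OF assms sub] centralizer_subgroup[OF sub]
    by (intro generate_subgroup_incl) auto
  then show "centralizer G S \<subseteq> centralizer G (generate G S)"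
    using subset_centralizer_commute[OF generate_incl[OF assms] sub] by blast
qed

text \<open>Needed for the quotient in the theorem to make sense.\<close>

lemma (in group) centralizer_Int_subset:
  assumes "A \<in> conjugacy_classes G" and "B \<in> conjugacy_classes G" and "D \<in> conjugacy_classes G"
    and "D \<subseteq> A <#> B"
  shows "centralizer G A \<inter> centralizer G B \<subseteq> centralizer G D"
proof
  fix g assume g: "g \<in> centralizer G A \<inter> centralizer G B"
  note sub = assms(1-3)[THEN conjugacy_class_subset]
  have "x \<otimes> g = g \<otimes> x" if x: "x \<in> D" for x
  proof -
    obtain a b where "a \<in> A" "b \<in> B" "x = a \<otimes> b"
      using x assms(4) unfolding set_mult_def by blast
    moreover from this have "a \<in> carrier G" "b \<in> carrier G" "g \<in> carrier G"
      "a \<otimes> g = g \<otimes> a" "b \<otimes> g = g \<otimes> b"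
      using g sub by (auto simp: centralizer_iff)
    ultimately show ?thesis by (metis m_assoc)
  qed
  then show "g \<in> centralizer G D" using g sub by (auto simp: centralizer_iff)
qed

text \<open>Conjugating one factorization \<open>d = a \<otimes> b\<close> makes every element of
  \<open>B\<close> the right factor of an element of \<open>D\<close> with left factor in
  \<open>A\<close>. Whatever commutes with the product and the left factor commutes with the right
  one.\<close>

lemma (in group) centralizer_factor:
  assumes "A \<in> conjugacy_classes G" and "B \<in> conjugacy_classes G" and "D \<in> conjugacy_classes G"
    and "D \<subseteq> A <#> B"
  shows "centralizer G A \<inter> centralizer G D \<subseteq> centralizer G B"
proof
  fix g assume g: "g \<in> centralizer G A \<inter> centralizer G D"
  note sub = assms(1-3)[THEN conjugacy_class_subset]
  obtain d where d: "d \<in> D" using assms(3) unfolding conjugacy_classes_eq by auto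
  then obtain a b where ab: "a \<in> A" "b \<in> B" "d = a \<otimes> b"
    using assms(4) unfolding set_mult_def by auto
  have "x \<otimes> g = g \<otimes> x" if "x \<in> B" for x
  proof -
    obtain k where k: "k \<in> carrier G" "x = k \<otimes> b \<otimes> inv k"
      using conjugacy_class_eq_orbit[OF assms(2) ab(2)] \<open>x \<in> B\<close> by auto
    let ?a = "k \<otimes> a \<otimes> inv k" and ?d = "k \<otimes> d \<otimes> inv k"
    have c: "a \<in> carrier G" "b \<in> carrier G" "g \<in> carrier G" "?a \<in> carrier G" "x \<in> carrier G"
      using ab sub g k \<open>x \<in> B\<close> by (auto simp: centralizer_iff)
    have "?a \<in> A" "?d \<in> D"
      using conjugacy_class_conj_closed k(1) ab(1) d assms(1,3) by auto
    then have com: "?a \<otimes> g = g \<otimes> ?a" "?d \<otimes> g = g \<otimes> ?d"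
      using g sub by (auto simp: centralizer_iff)
    have dx: "?d = ?a \<otimes> x" using c(1,2) k ab(3) by (simp add: m_assoc inv_mult_cancel)
    have "?a \<otimes> (x \<otimes> g) = g \<otimes> ?a \<otimes> x" using com(2) c(3-5) unfolding dx by (simp only: m_assoc)
    also have "\<dots> = ?a \<otimes> (g \<otimes> x)" using com(1) c(3-5) by (metis m_assoc)
    finally show ?thesis using c(3-5) by (metis l_cancel m_closed)
  qed
  then show "g \<in> centralizer G B" using g sub by (auto simp: centralizer_iff)
qed

section \<open>Derived length\<close>

text \<open>The projection maps the derived series of \<open>G\<close> onto that of the quotient,
  and its kernel is \<open>H\<close>.\<close>

lemma (in normal) exp_of_derived_FactGroup:
  "(derived (G Mod H) ^^ n) (carrier (G Mod H)) = {\<one>\<^bsub>G Mod H\<^esub>} \<longleftrightarrow>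
   (derived G ^^ n) (carrier G) \<subseteq> H"
proof -
  interpret Q: group_hom G "G Mod H" "\<lambda>x. H #> x"
    using factorgroup_is_group r_coset_hom_Mod
    by (simp add: group_hom_def group_hom_axioms_def is_group)
  let ?D = "(derived G ^^ n) (carrier G)"
  have D: "subgroup ?D G" by (rule exp_of_derived_is_subgroup[OF subgroup_self])
  have "(derived (G Mod H) ^^ n) (carrier (G Mod H)) = (\<lambda>x. H #> x) ` ?D"
    using Q.exp_of_derived_img[OF subset_refl, of n] by (simp add: carrier_FactGroup)
  moreover have "(\<lambda>x. H #> x) ` ?D = {\<one>\<^bsub>G Mod H\<^esub>} \<longleftrightarrow> (\<forall>x\<in>?D. H #> x = H)"
    using subgroup.one_closed[OF D] by auto
  moreover have "H #> x = H \<longleftrightarrow> x \<in> H" if "x \<in> ?D" for x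
    using subgroup.mem_carrier[OF D that] coset_join1[OF _ _ subgroup_axioms]
      rcos_const[OF is_group] subset by blast
  ultimately show ?thesis by auto
qed

text \<open>Solvability guarantees that the minimum in \<open>derived_length\<close> is
  attained.\<close>

lemma (in normal) exp_of_derived_length_FactGroup:
  assumes "solvable (G Mod H)"
  shows "(derived G ^^ derived_length (G Mod H)) (carrier G) \<subseteq> H"
proof -
  interpret Q: group "G Mod H" by (rule factorgroup_is_group)
  have "\<exists>n. (derived (G Mod H) ^^ n) (carrier (G Mod H)) = {\<one>\<^bsub>G Mod H\<^esub>}"
    using assms Q.solvable_iff_trivial_derived_seq by blast
  then show ?thesis
    unfolding exp_of_derived_FactGroup[symmetric] derived_length_def by (rule LeastI_ex)
qed

lemma (in normal) solvable_FactGroupI: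
  assumes "(derived G ^^ n) (carrier G) \<subseteq> H"
  shows "solvable (G Mod H) \<and> derived_length (G Mod H) \<le> n"
proof -
  interpret Q: group "G Mod H" by (rule factorgroup_is_group)
  show ?thesis
    using assms Q.solvable_iff_trivial_derived_seq unfolding exp_of_derived_FactGroup[symmetric]
    by (auto simp: derived_length_def intro: Least_le)
qed

lemma (in group) exp_of_derived_incl:
  assumes "subgroup H G"
  shows "(derived G ^^ n) H \<subseteq> H"
  using derived_incl[OF _ assms] by (induct n) auto

text \<open>Bridges the series of a subgroup taken as a group of its own, as in the theorem, and the
  series computed inside \<open>G\<close>.\<close>

lemma (in group) exp_of_derived_consistent:
  assumes "subgroup H G"
  shows "(derived (G\<lparr>carrier := H\<rparr>) ^^ n) H = (derived G ^^ n) H"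
  by (induct n) (auto simp: derived_consistent[OF exp_of_derived_incl[OF assms] assms])

section \<open>The commutator argument\<close>

text \<open>Moving \<open>x\<close> past \<open>a\<close> costs a factor \<open>m\<close>, moving
  \<open>y\<close> costs \<open>n\<close>. Since these factors commute with everything but possibly
  \<open>a\<close>, both \<open>x \<otimes> y\<close> and \<open>y \<otimes> x\<close> cost
  \<open>m \<otimes> n\<close>, so their quotient, the commutator, costs nothing.\<close>

lemma (in group) commutator_commutes:
  assumes "a \<in> carrier G" "x \<in> carrier G" "y \<in> carrier G" "m \<in> carrier G" "n \<in> carrier G"
    and "x \<otimes> a = a \<otimes> m \<otimes> x" and "y \<otimes> a = a \<otimes> n \<otimes> y"
    and "x \<otimes> m = m \<otimes> x" and "x \<otimes> n = n \<otimes> x" and "y \<otimes> m = m \<otimes> y" and "y \<otimes> n = n \<otimes> y"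
    and "m \<otimes> n = n \<otimes> m"
  shows "a \<otimes> (x \<otimes> y \<otimes> inv x \<otimes> inv y) = x \<otimes> y \<otimes> inv x \<otimes> inv y \<otimes> a"
proof -
  let ?k = "m \<otimes> n" and ?u = "x \<otimes> y" and ?v = "y \<otimes> x"
  let ?w = "?u \<otimes> inv ?v"
  note c = assms(1-5)
  have u: "?u \<otimes> a = a \<otimes> ?k \<otimes> ?u"
  proof -
    have "?u \<otimes> a = x \<otimes> a \<otimes> n \<otimes> y" using c assms(7) by (simp add: m_assoc)
    also have "\<dots> = a \<otimes> m \<otimes> (x \<otimes> n) \<otimes> y" using c assms(6) by (simp add: m_assoc)
    also have "\<dots> = a \<otimes> ?k \<otimes> ?u" using c unfolding assms(9) by (simp add: m_assoc)
    finally show ?thesis .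
  qed
  have v: "?v \<otimes> a = a \<otimes> ?k \<otimes> ?v"
  proof -
    have "?v \<otimes> a = y \<otimes> a \<otimes> m \<otimes> x" using c assms(6) by (simp add: m_assoc)
    also have "\<dots> = a \<otimes> n \<otimes> (y \<otimes> m) \<otimes> x" using c assms(7) by (simp add: m_assoc)
    also have "\<dots> = a \<otimes> (n \<otimes> m) \<otimes> ?v" using c unfolding assms(10) by (simp add: m_assoc)
    finally show ?thesis using assms(12) by simp
  qed
  have wv: "?w \<otimes> ?v = ?u" using c by (simp add: m_assoc)
  have "subgroup (centralizer G {m, n}) G" using c by (intro centralizer_subgroup) auto
  moreover have "x \<in> centralizer G {m, n}" "y \<in> centralizer G {m, n}"
    using assms by (auto simp: centralizer_iff)
  ultimately have "?w \<in> centralizer G {m, n}"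
    by (meson subgroup.m_closed subgroup.m_inv_closed)
  then have mn: "m \<otimes> ?w = ?w \<otimes> m" "n \<otimes> ?w = ?w \<otimes> n" using c by (auto simp: centralizer_iff)
  have wc: "?w \<in> carrier G" using c by simp
  have k: "?k \<otimes> ?w = ?w \<otimes> ?k" using mn wc c by (metis m_assoc)
  \<comment> \<open>Evaluate \<open>?w \<otimes> ?v \<otimes> a\<close> in two ways, then cancel
    \<open>?k \<otimes> ?v\<close> on the right.\<close>
  have "?w \<otimes> a \<otimes> (?k \<otimes> ?v) = ?w \<otimes> (?v \<otimes> a)" using v wc c by (simp add: m_assoc)
  also have "\<dots> = ?u \<otimes> a" using wv wc c by (metis m_assoc m_closed)
  also have "\<dots> = a \<otimes> ?k \<otimes> (?w \<otimes> ?v)" using u wv by simp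
  also have "\<dots> = a \<otimes> (?k \<otimes> ?w) \<otimes> ?v" using wc c by (simp add: m_assoc)
  also have "\<dots> = a \<otimes> ?w \<otimes> (?k \<otimes> ?v)" unfolding k using wc c by (simp add: m_assoc)
  finally have "?w \<otimes> a = a \<otimes> ?w"
    using wc c by (metis m_closed r_cancel)
  moreover have "?w = x \<otimes> y \<otimes> inv x \<otimes> inv y" using c by (simp add: m_assoc inv_mult_group)
  ultimately show ?thesis by simp
qed

text \<open>The elements \<open>inv a \<otimes> x \<otimes> a \<otimes> inv x\<close> lie in
  \<open>M\<close> by hypothesis and in \<open>C\<close> by normality. As \<open>C\<close>
  centralizes \<open>M\<close>, they commute with \<open>P\<close> and with each other, so
  \<open>commutator_commutes\<close> applies.\<close>

lemma (in group) derived_subset_centralizer: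
  assumes "C \<lhd> G" and "M \<subseteq> carrier G" and "C \<subseteq> centralizer G M" and "P \<subseteq> C"
    and "a \<in> carrier G"
    and M: "\<And>x. x \<in> P \<Longrightarrow> inv a \<otimes> x \<otimes> a \<otimes> inv x \<in> M"
  shows "derived G P \<subseteq> centralizer G {a}"
proof -
  interpret C: normal C G by (rule assms(1))
  have com: "x \<otimes> m = m \<otimes> x" if "x \<in> C" "m \<in> M" for x m
    using that assms(2,3) by (auto simp: centralizer_iff subset_iff)
  let ?m = "\<lambda>x. inv a \<otimes> x \<otimes> a \<otimes> inv x"
  have MC: "?m x \<in> C" if "x \<in> P" for x
  proof -
    have "inv a \<otimes> x \<otimes> inv (inv a) \<in> C"
      using that assms(4,5) by (intro C.inv_op_closed2) auto
    then show ?thesis using that assms(4,5) by auto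
  qed
  have "x \<otimes> y \<otimes> inv x \<otimes> inv y \<in> centralizer G {a}" if xy: "x \<in> P" "y \<in> P" for x y
  proof -
    have c: "x \<in> carrier G" "y \<in> carrier G" using xy assms(4) by auto
    have *: "z \<otimes> a = a \<otimes> ?m z \<otimes> z" if "z \<in> carrier G" for z
      using that assms(5) by (simp add: m_assoc inv_mult_cancel)
    have "a \<otimes> (x \<otimes> y \<otimes> inv x \<otimes> inv y) = x \<otimes> y \<otimes> inv x \<otimes> inv y \<otimes> a"
      using xy c assms(4) M MC C.mem_carrier
      by (intro commutator_commutes[OF assms(5) c _ _ * *] com) blast+
    then show ?thesis using c assms(5) by (simp add: centralizer_iff)
  qed
  \<comment> \<open>The centralizer is a subgroup, so it suffices that it contains the generating
    commutators.\<close>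
  then show ?thesis
    unfolding derived_def using assms(5)
    by (intro generate_subgroup_incl centralizer_subgroup) auto
qed

theorem theorem2p3:
  fixes G :: "('a, 'b) monoid_scheme" and F :: "nat \<Rightarrow> real" and A B D :: "'a set"
  assumes "group G" and "finite (carrier G)"
    and "mono F"
    and "\<And>(H :: 'a set monoid) h. group H \<Longrightarrow> h \<in> epi G H \<Longrightarrow> good_for F H"
    and "A \<in> conjugacy_classes G" and "B \<in> conjugacy_classes G" and "D \<in> conjugacy_classes G"
    and "D \<subseteq> A <#>\<^bsub>G\<^esub> B"
  shows "solvable ((G\<lparr>carrier := centralizer G D\<rparr>) Mod (centralizer G A \<inter> centralizer G B)) \<and>
    real (derived_length ((G\<lparr>carrier := centralizer G D\<rparr>) Mod (centralizer G A \<inter> centralizer G B)))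
      \<le> 1 + F (eta G (A <#>\<^bsub>G\<^esub> B))"
proof -

  \<comment> \<open>The quotient by the subgroup generated by \<open>D\<close>\<close>
  interpret G: group G by (rule assms(1))
  define M where "M = generate G D"
  define C where "C = centralizer G D"
  define H where "H = G Mod M"
  define h where "h = (\<lambda>x. M #>\<^bsub>G\<^esub> x)"
  note sub = assms(5-7)[THEN G.conjugacy_class_subset]
  have M: "M \<lhd> G"
    unfolding M_def
    by (rule G.normal_generateI[OF sub(3) G.conjugacy_class_conj_closed[OF assms(7)]])
  interpret M: normal M G by (rule M)
  have "group H" unfolding H_def by (rule M.factorgroup_is_group)
  have hom: "h \<in> hom G H" unfolding h_def H_def by (rule M.r_coset_hom_Mod)
  interpret h: group_hom G H h
    using \<open>group H\<close> hom by (simp add: group_hom_def group_hom_axioms_def G.is_group)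
  have surj: "h ` carrier G = carrier H" unfolding h_def H_def by (simp add: carrier_FactGroup)
  have h_one: "h x = \<one>\<^bsub>H\<^esub> \<longleftrightarrow> x \<in> M" if "x \<in> carrier G" for x
    using that G.coset_join1[OF _ _ M.subgroup_axioms] M.rcos_const[OF G.is_group] M.subset
    unfolding h_def H_def by auto
  have good: "good_for F H"
    using assms(4)[OF \<open>group H\<close>] hom surj unfolding epi_def by blast

  \<comment> \<open>The images of \<open>A\<close> and \<open>B\<close> modulo
    \<open>M\<close>\<close>
  have hA: "h ` A \<in> conjugacy_classes H" by (rule h.conjugacy_class_img[OF surj assms(5)])
  have hB: "h ` B \<in> conjugacy_classes H" by (rule h.conjugacy_class_img[OF surj assms(6)])
  obtain d where d: "d \<in> D" using assms(7) unfolding G.conjugacy_classes_eq by auto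
  then obtain a b where ab: "a \<in> A" "b \<in> B" "d = a \<otimes>\<^bsub>G\<^esub> b"
    using assms(8) unfolding set_mult_def by auto
  have abc: "a \<in> carrier G" "b \<in> carrier G" using ab sub by auto
  have "h d = \<one>\<^bsub>H\<^esub>" using h_one d sub(3) unfolding M_def by (auto intro: generate.incl)
  then have hb: "h b = inv\<^bsub>H\<^esub> h a"
    using ab(3) abc by (metis h.H.inv_equality h.H.inv_inv h.hom_closed h.hom_mult)
  \<comment> \<open>Based at \<open>h b\<close>, the inverse of \<open>h a\<close>, this class
    consists of the inverses of the conjugates of \<open>h a\<close>.\<close>
  have "h ` B = (\<lambda>g. g \<otimes>\<^bsub>H\<^esub> h b \<otimes>\<^bsub>H\<^esub> inv\<^bsub>H\<^esub> g) ` carrier H"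
    using h.H.conjugacy_class_eq_orbit[OF hB] ab(2) by blast
  also have "\<dots> = (\<lambda>g. inv\<^bsub>H\<^esub> (g \<otimes>\<^bsub>H\<^esub> h a \<otimes>\<^bsub>H\<^esub> inv\<^bsub>H\<^esub> g)) ` carrier H"
    using abc by (intro image_cong) (auto simp: hb h.H.inv_mult_group h.H.m_assoc)
  also have "\<dots> = (\<lambda>x. inv\<^bsub>H\<^esub> x) ` h ` A"
    unfolding h.H.conjugacy_class_eq_orbit[OF hA imageI[OF ab(1)]] image_image ..
  also have "\<dots> = set_inv\<^bsub>H\<^esub> (h ` A)" unfolding SET_INV_def by auto
  finally have hAB: "h ` (A <#>\<^bsub>G\<^esub> B) = h ` A <#>\<^bsub>H\<^esub> set_inv\<^bsub>H\<^esub> (h ` A)"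
    using set_mult_hom[OF hom sub(1,2)] by simp
  have "eta H (h ` (A <#>\<^bsub>G\<^esub> B)) \<le> eta G (A <#>\<^bsub>G\<^esub> B)"
    using G.set_mult_closed[OF sub(1,2)] G.set_mult_conj_closed[OF assms(5,6)]
    by (rule h.eta_img_le[OF surj assms(2)])
  then have F_le: "F (eta H (h ` A <#>\<^bsub>H\<^esub> set_inv\<^bsub>H\<^esub> (h ` A))) \<le> F (eta G (A <#>\<^bsub>G\<^esub> B))"
    unfolding hAB by (rule monoD[OF assms(3)])

  \<comment> \<open>The derived length supplied by goodness of \<open>H\<close>\<close>
  define l where "l = derived_length (H Mod centralizer H (h ` A))"
  have l: "solvable (H Mod centralizer H (h ` A))" "real l \<le> F (eta G (A <#>\<^bsub>G\<^esub> B))"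
    using good hA F_le unfolding good_for_def l_def by force+
  have "(derived H ^^ l) (carrier H) \<subseteq> centralizer H (h ` A)"
    using normal.exp_of_derived_length_FactGroup[OF
      h.H.centralizer_conjugacy_class_normal[OF hA] l(1)] unfolding l_def .
  \<comment> \<open>Surjectivity of \<open>h\<close> carries the derived series of \<open>G\<close>
    onto that of \<open>H\<close>.\<close>
  then have cent: "h ` (derived G ^^ l) (carrier G) \<subseteq> centralizer H (h ` A)"
    using h.exp_of_derived_img[OF subset_refl, of l] surj by simp

  \<comment> \<open>Commutators inside the centralizer of \<open>D\<close>\<close>
  have Cn: "C \<lhd> G" unfolding C_def by (rule G.centralizer_conjugacy_class_normal[OF assms(7)])
  have C: "subgroup C G" using Cn by (rule normal_imp_subgroup)
  define P where "P = (derived G ^^ l) C"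
  have PC: "P \<subseteq> C" unfolding P_def by (rule G.exp_of_derived_incl[OF C])
  have CM: "C \<subseteq> centralizer G M" unfolding C_def M_def by (simp add: G.centralizer_generate sub(3))
  have "derived G P \<subseteq> centralizer G {a}" if a: "a \<in> A" for a
  proof (rule G.derived_subset_centralizer[OF Cn M.subset CM PC])
    show ac: "a \<in> carrier G" using a sub by blast
    \<comment> \<open>The images of \<open>x\<close> and \<open>a\<close> commute in
      \<open>H\<close>, so their commutator lies in the kernel \<open>M\<close> of
      \<open>h\<close>.\<close>
    fix x assume x: "x \<in> P"
    have xc: "x \<in> carrier G" using x PC subgroup.subset[OF C] by blast
    have "x \<in> (derived G ^^ l) (carrier G)"
      using x G.mono_exp_of_derived[OF subgroup.subset[OF C]] unfolding P_def by blast
    then have "h x \<in> centralizer H (h ` A)" using cent by blast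
    moreover have "h ` A \<subseteq> carrier H" by (rule h.H.conjugacy_class_subset[OF hA])
    ultimately have "h a \<otimes>\<^bsub>H\<^esub> h x = h x \<otimes>\<^bsub>H\<^esub> h a"
      using a by (auto simp: h.H.centralizer_iff)
    then have "inv\<^bsub>H\<^esub> h a \<otimes>\<^bsub>H\<^esub> (h x \<otimes>\<^bsub>H\<^esub> h a) = h x"
      using ac xc by (metis h.H.inv_solve_left h.hom_closed h.H.m_closed)
    then have "h (inv\<^bsub>G\<^esub> a \<otimes>\<^bsub>G\<^esub> x \<otimes>\<^bsub>G\<^esub> a \<otimes>\<^bsub>G\<^esub> inv\<^bsub>G\<^esub> x) = \<one>\<^bsub>H\<^esub>"
      using ac xc by (simp add: h.H.m_assoc[of "inv\<^bsub>H\<^esub> h a" "h x" "h a"])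
    moreover have "inv\<^bsub>G\<^esub> a \<otimes>\<^bsub>G\<^esub> x \<otimes>\<^bsub>G\<^esub> a \<otimes>\<^bsub>G\<^esub> inv\<^bsub>G\<^esub> x \<in> carrier G" using ac xc by simp
    ultimately show "inv\<^bsub>G\<^esub> a \<otimes>\<^bsub>G\<^esub> x \<otimes>\<^bsub>G\<^esub> a \<otimes>\<^bsub>G\<^esub> inv\<^bsub>G\<^esub> x \<in> M" using h_one by blast
  qed
  then have PA: "derived G P \<subseteq> centralizer G A"
    using G.derived_in_carrier[OF subset_trans[OF PC subgroup.subset[OF C]]]
    unfolding centralizer_def by auto
  moreover have "derived G P \<subseteq> C" by (rule G.derived_incl[OF PC C])
  \<comment> \<open>\<open>P\<close> uses \<open>l\<close> derivations and
    \<open>derived G P\<close> one more, which is the summand 1 in the bound. Lying in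
    \<open>C\<close> as well as in the centralizer of \<open>A\<close>, it centralizes
    \<open>B\<close> by \<open>centralizer_factor\<close>.\<close>
  ultimately have PAB: "(derived G ^^ Suc l) C \<subseteq> centralizer G A \<inter> centralizer G B"
    using G.centralizer_factor[OF assms(5-8)] unfolding C_def P_def by auto

  \<comment> \<open>Passage to the quotient of \<open>C\<close>\<close>
  have "centralizer G A \<inter> centralizer G B \<lhd> G"
    using assms(5,6) by (intro G.normal_subgroup_intersect G.centralizer_conjugacy_class_normal)
  then have "centralizer G A \<inter> centralizer G B \<lhd> G\<lparr>carrier := C\<rparr>"
    using G.centralizer_Int_subset[OF assms(5-8)] C unfolding C_def
    by (intro G.normal_restrict_supergroup)
  then have "solvable ((G\<lparr>carrier := C\<rparr>) Mod (centralizer G A \<inter> centralizer G B)) \<and>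
      derived_length ((G\<lparr>carrier := C\<rparr>) Mod (centralizer G A \<inter> centralizer G B)) \<le> Suc l"
    using PAB G.exp_of_derived_consistent[OF C, of "Suc l"]
    by (intro normal.solvable_FactGroupI) simp_all
  then show ?thesis using l(2) unfolding C_def by auto
qed

end
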